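(* Fix $B\ge 2$ and let $d=\gcd(2,B-1)$. For each $D\in\{d,-d,id,-id\}$ there exist arbitrarily long finite $D$-consecutive sequences of Gaussian $B$-happy numbers (i.e. for every $m\ge1$ there is one of length $m$), and $d$ is the smallest positive integer $c$ for which there exist arbitrarily long finite $c$-consecutive sequences of Gaussian $B$-happy numbers.
   Context: Fix an integer $B\ge 2$. Every nonzero Gaussian integer $a+bi$ is written uniquely as $a+bi=\sum_{j=0}^n (a_j+b_ji)B^j$ with $a_j,b_j\in\mathbb{Z}$, $a_n,b_n$ not both $0$, and for each $j$: $|a_j|\le B-1$, $|b_j|\le B-1$, $\operatorname{sgn}(a)a_j\ge 0$, $\operatorname{sgn}(b)b_j\ge 0$. The Gaussian $B$-happy function $S_B:\mathbb{Z}[i]\to\mathbb{Z}[i]$ is defined by $S_B(0)=0$ and $S_B(a+bi)=\sum_{j=0}^n (a_j+b_ji)^2$. A Gaussian integer $z$ is Gaussian $B$-happy if $S_B^k(z)=1$ for some $k\ge1$. For $D\in\mathbb{Z}[i]\setminus\{0\}$, a $D$-consecutive sequence of length $m$ is a sequence $z,z+D,\dots,z+(m-1)D$ with $z\in\mathbb{Z}[i]$. *)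

theory Defs
  imports Complex_Main
begin

definition gauss_ints :: "complex set" where
  "gauss_ints = {Complex (of_int a) (of_int b) | a b :: int. True}"

definition gauss_expansion ::
    "int \<Rightarrow> complex \<Rightarrow> nat \<Rightarrow> (nat \<Rightarrow> int) \<Rightarrow> (nat \<Rightarrow> int) \<Rightarrow> bool" where
  "gauss_expansion B z n a b \<longleftrightarrow>
     z = (\<Sum>j\<le>n. Complex (of_int (a j)) (of_int (b j)) * of_int B ^ j) \<and>
     (a n \<noteq> 0 \<or> b n \<noteq> 0) \<and>
     (\<forall>j\<le>n. \<bar>a j\<bar> \<le> B - 1 \<and> \<bar>b j\<bar> \<le> B - 1 \<and>
        sgn (Re z) * of_int (a j) \<ge> 0 \<and> sgn (Im z) * of_int (b j) \<ge> 0)"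

text \<open>The description in the nonzero case is well defined for Gaussian integers and
  \<open>B \<ge> 2\<close>; see \<open>gauss_happy_fun_eq\<close> and \<open>gauss_expansion_exists\<close> below.\<close>

definition gauss_happy_fun :: "int \<Rightarrow> complex \<Rightarrow> complex" where
  "gauss_happy_fun B z =
     (if z = 0 then 0
      else THE w. \<exists>n a b. gauss_expansion B z n a b \<and>
             w = (\<Sum>j\<le>n. (Complex (of_int (a j)) (of_int (b j)))\<^sup>2))"

definition gauss_happy :: "int \<Rightarrow> complex \<Rightarrow> bool" where
  "gauss_happy B z \<longleftrightarrow> z \<in> gauss_ints \<and> (\<exists>k\<ge>1. (gauss_happy_fun B ^^ k) z = 1)"

definition consecutive_seq :: "complex \<Rightarrow> nat \<Rightarrow> complex list \<Rightarrow> bool" where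
  "consecutive_seq D m zs \<longleftrightarrow>
     (\<exists>z\<in>gauss_ints. zs = map (\<lambda>j. z + of_nat j * D) [0..<m])"

definition arb_long_happy_seqs :: "int \<Rightarrow> complex \<Rightarrow> bool" where
  "arb_long_happy_seqs B D \<longleftrightarrow>
     (\<forall>m\<ge>1. \<exists>zs. consecutive_seq D m zs \<and> (\<forall>z\<in>set zs. gauss_happy B z))"

lemma small_digits_zero:
  fixes B :: int and h :: "nat \<Rightarrow> int"
  assumes "B \<ge> 2" and "\<forall>j<N. \<bar>h j\<bar> \<le> B - 1" and "(\<Sum>j<N. h j * B ^ j) = 0"
  shows "\<forall>j<N. h j = 0"
  using assms(2,3)
proof (induction N arbitrary: h)
  case 0
  then show ?case by simp
next
  case (Suc N)
  have eq: "h 0 + B * (\<Sum>j<N. h (Suc j) * B ^ j) = 0"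
    using Suc.prems(2)
    by (simp add: sum.lessThan_Suc_shift sum_distrib_left algebra_simps del: sum.lessThan_Suc)
  have "B dvd h 0"
    using eq by (metis dvd_add_left_iff dvd_0_right dvd_triv_left)
  moreover have "\<bar>h 0\<bar> \<le> B - 1" using Suc.prems(1) by simp
  ultimately have h0: "h 0 = 0"
    using dvd_imp_le_int[of "h 0" B] assms(1) by linarith
  with eq assms(1) have "(\<Sum>j<N. h (Suc j) * B ^ j) = 0" by simp
  then have "\<forall>j<N. h (Suc j) = 0"
    by (intro Suc.IH) (use Suc.prems(1) in blast)+
  with h0 show ?case by (auto simp: less_Suc_eq_0_disj)
qed

lemma signed_digits_unique:
  fixes B x :: int and f g :: "nat \<Rightarrow> int"
  assumes "B \<ge> 2"
    and f: "\<forall>j<N. \<bar>f j\<bar> \<le> B - 1 \<and> sgn x * f j \<ge> 0" "(\<Sum>j<N. f j * B ^ j) = x"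
    and g: "\<forall>j<N. \<bar>g j\<bar> \<le> B - 1 \<and> sgn x * g j \<ge> 0" "(\<Sum>j<N. g j * B ^ j) = x"
  shows "\<forall>j<N. f j = g j"
proof (cases "x = 0")
  case True
  have "\<forall>j<N. f j = 0"
    by (rule small_digits_zero[OF assms(1)]) (use f True in blast)+
  moreover have "\<forall>j<N. g j = 0"
    by (rule small_digits_zero[OF assms(1)]) (use g True in blast)+
  ultimately show ?thesis by simp
next
  case False
  have "\<forall>j<N. \<bar>f j - g j\<bar> \<le> B - 1"
  proof (intro allI impI)
    fix j assume "j < N"
    then have "\<bar>f j\<bar> \<le> B - 1" "\<bar>g j\<bar> \<le> B - 1" "sgn x * f j \<ge> 0" "sgn x * g j \<ge> 0"
      using f g by auto
    then show "\<bar>f j - g j\<bar> \<le> B - 1"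
      using False by (cases "x > 0") auto
  qed
  moreover have "(\<Sum>j<N. (f j - g j) * B ^ j) = 0"
    using f g by (simp add: left_diff_distrib sum_subtractf)
  ultimately have "\<forall>j<N. f j - g j = 0"
    by (rule small_digits_zero[OF assms(1)])
  then show ?thesis by simp
qed

lemma signed_digits_exist:
  fixes B x :: int
  assumes "B \<ge> 2"
  obtains f :: "nat \<Rightarrow> int" and N where
    "\<forall>j. \<bar>f j\<bar> \<le> B - 1 \<and> sgn x * f j \<ge> 0"
    "\<forall>j\<ge>N. f j = 0" "\<forall>n\<ge>N. (\<Sum>j<n. f j * B ^ j) = x"
proof -
  define g where "g j = \<bar>x\<bar> div B ^ j mod B" for j
  have g: "0 \<le> g j" "g j \<le> B - 1" for j
    using assms pos_mod_bound[of B "\<bar>x\<bar> div B ^ j"] by (auto simp: g_def)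
  have sum: "(\<Sum>j<n. g j * B ^ j) = \<bar>x\<bar> mod B ^ n" for n
  proof (induction n)
    case (Suc n)
    have "\<bar>x\<bar> mod (B ^ n * B) = B ^ n * (\<bar>x\<bar> div B ^ n mod B) + \<bar>x\<bar> mod B ^ n"
      using assms by (intro zmod_zmult2_eq) auto
    with Suc show ?case by (simp add: g_def mult.commute)
  qed simp
  define N where "N = nat \<bar>x\<bar>"
  have lt: "\<bar>x\<bar> < B ^ n" if "n \<ge> N" for n
  proof -
    have "int n < 2 ^ n" by (metis of_nat_less_two_power)
    also have "(2::int) ^ n \<le> B ^ n" using assms by (intro power_mono) auto
    finally show ?thesis using that by (simp add: N_def)
  qed
  show ?thesis
  proof (rule that[of "\<lambda>j. sgn x * g j" N])
    show "\<forall>j. \<bar>sgn x * g j\<bar> \<le> B - 1 \<and> sgn x * (sgn x * g j) \<ge> 0"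
      using g assms by (cases x "0::int" rule: linorder_cases) auto
    show "\<forall>j\<ge>N. sgn x * g j = 0"
      using lt by (simp add: g_def div_pos_pos_trivial)
    show "\<forall>n\<ge>N. (\<Sum>j<n. sgn x * g j * B ^ j) = x"
    proof (intro allI impI)
      fix n assume "n \<ge> N"
      then have "(\<Sum>j<n. g j * B ^ j) = \<bar>x\<bar>" using sum lt by simp
      then show "(\<Sum>j<n. sgn x * g j * B ^ j) = x"
        by (simp add: mult.assoc sum_distrib_left[symmetric] sgn_mult_abs)
    qed
  qed
qed

lemma Complex_digit_sum:
  "(\<Sum>j\<in>A. Complex (of_int (a j)) (of_int (b j)) * of_int B ^ j) =
   Complex (of_int (\<Sum>j\<in>A. a j * B ^ j)) (of_int (\<Sum>j\<in>A. b j * B ^ j))"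
proof -
  have *: "of_int B ^ j = complex_of_real (of_int (B ^ j))" for j by simp
  show ?thesis
    unfolding * by (rule complex_eqI) (simp_all del: of_int_power of_real_of_int_eq)
qed

lemma gauss_expansion_Complex_iff:
  "gauss_expansion B (Complex (of_int x) (of_int y)) n a b \<longleftrightarrow>
     x = (\<Sum>j\<le>n. a j * B ^ j) \<and> y = (\<Sum>j\<le>n. b j * B ^ j) \<and>
     (a n \<noteq> 0 \<or> b n \<noteq> 0) \<and>
     (\<forall>j\<le>n. \<bar>a j\<bar> \<le> B - 1 \<and> \<bar>b j\<bar> \<le> B - 1 \<and> sgn x * a j \<ge> 0 \<and> sgn y * b j \<ge> 0)"
proof -
  have "sgn (real_of_int u) * real_of_int v \<ge> 0 \<longleftrightarrow> sgn u * v \<ge> 0" for u v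
    by (cases u "0::int" rule: linorder_cases) auto
  then show ?thesis
    unfolding gauss_expansion_def Complex_digit_sum
    by (simp del: of_int_sum)
qed

lemma gauss_expansion_exists:
  assumes "B \<ge> 2" "z \<in> gauss_ints" "z \<noteq> 0"
  shows "\<exists>n a b. gauss_expansion B z n a b"
proof -
  obtain x y where z: "z = Complex (of_int x) (of_int y)"
    using assms(2) by (auto simp: gauss_ints_def)
  obtain a N where a: "\<forall>j. \<bar>a j\<bar> \<le> B - 1 \<and> sgn x * a j \<ge> 0"
      "\<forall>j\<ge>N. a j = 0" "\<forall>n\<ge>N. (\<Sum>j<n. a j * B ^ j) = x"
    using signed_digits_exist[OF assms(1)] by metis
  obtain b M where b: "\<forall>j. \<bar>b j\<bar> \<le> B - 1 \<and> sgn y * b j \<ge> 0"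
      "\<forall>j\<ge>M. b j = 0" "\<forall>n\<ge>M. (\<Sum>j<n. b j * B ^ j) = y"
    using signed_digits_exist[OF assms(1)] by metis
  define K where "K = max N M"
  define A where "A = {j. a j \<noteq> 0 \<or> b j \<noteq> 0}"
  have sub: "A \<subseteq> {..<K}" using a(2) b(2) by (auto simp: A_def K_def not_le[symmetric])
  then have fin: "finite A" by (rule finite_subset) simp
  have ne: "A \<noteq> {}"
  proof
    assume "A = {}"
    then have "x = 0" "y = 0" using a(3) b(3) by (auto simp: A_def)
    with z assms(3) show False by (simp add: complex_eq_iff)
  qed
  define n where "n = Max A"
  have nA: "n \<in> A" using Max_in[OF fin ne] by (simp add: n_def)
  have big: "j \<notin> A" if "j > n" for j using Max_ge[OF fin, of j] that by (auto simp: n_def)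
  have "(\<Sum>j\<le>n. a j * B ^ j) = (\<Sum>j<K. a j * B ^ j)"
    using nA sub big by (intro sum.mono_neutral_left) (auto simp: A_def not_le)
  moreover have "(\<Sum>j\<le>n. b j * B ^ j) = (\<Sum>j<K. b j * B ^ j)"
    using nA sub big by (intro sum.mono_neutral_left) (auto simp: A_def not_le)
  ultimately have "gauss_expansion B z n a b"
    unfolding z gauss_expansion_Complex_iff using a b nA by (auto simp: A_def K_def)
  then show ?thesis by blast
qed

lemma gauss_expansion_unique:
  assumes "B \<ge> 2" "z \<in> gauss_ints"
    and e: "gauss_expansion B z n a b" and e': "gauss_expansion B z n' a' b'"
  shows "n = n' \<and> (\<forall>j\<le>n. a j = a' j \<and> b j = b' j)"
proof -
  obtain x y where z: "z = Complex (of_int x) (of_int y)"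
    using assms(2) by (auto simp: gauss_ints_def)
  define N where "N = Suc (max n n')"
  define cut where "cut k f j = (if j \<le> k then f j else 0)" for k :: nat and f :: "nat \<Rightarrow> int" and j
  have cut_sum: "(\<Sum>j<N. cut k f j * B ^ j) = (\<Sum>j\<le>k. f j * B ^ j)" if "k < N" for k f
    using that by (intro sum.mono_neutral_cong_right) (auto simp: cut_def)
  have E: "(\<Sum>j\<le>n. a j * B ^ j) = x" "(\<Sum>j\<le>n. b j * B ^ j) = y" "a n \<noteq> 0 \<or> b n \<noteq> 0"
    "\<forall>j\<le>n. \<bar>a j\<bar> \<le> B - 1 \<and> sgn x * a j \<ge> 0" "\<forall>j\<le>n. \<bar>b j\<bar> \<le> B - 1 \<and> sgn y * b j \<ge> 0"
    using e[unfolded z gauss_expansion_Complex_iff] by blast+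
  have E': "(\<Sum>j\<le>n'. a' j * B ^ j) = x" "(\<Sum>j\<le>n'. b' j * B ^ j) = y" "a' n' \<noteq> 0 \<or> b' n' \<noteq> 0"
    "\<forall>j\<le>n'. \<bar>a' j\<bar> \<le> B - 1 \<and> sgn x * a' j \<ge> 0" "\<forall>j\<le>n'. \<bar>b' j\<bar> \<le> B - 1 \<and> sgn y * b' j \<ge> 0"
    using e'[unfolded z gauss_expansion_Complex_iff] by blast+
  have k: "n < N" "n' < N" by (auto simp: N_def)
  have cut_bd: "\<forall>j<N. \<bar>cut k f j\<bar> \<le> B - 1 \<and> sgn u * cut k f j \<ge> 0"
    if "\<forall>j\<le>k. \<bar>f j\<bar> \<le> B - 1 \<and> sgn u * f j \<ge> 0" for k f u
    using that assms(1) by (simp add: cut_def)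
  have "\<forall>j<N. cut n a j = cut n' a' j"
    using signed_digits_unique[OF assms(1) cut_bd[OF E(4)] _ cut_bd[OF E'(4)]]
      cut_sum[OF k(1), of a] cut_sum[OF k(2), of a'] E(1) E'(1) by metis
  moreover have "\<forall>j<N. cut n b j = cut n' b' j"
    using signed_digits_unique[OF assms(1) cut_bd[OF E(5)] _ cut_bd[OF E'(5)]]
      cut_sum[OF k(1), of b] cut_sum[OF k(2), of b'] E(2) E'(2) by metis
  ultimately have eq: "cut n a j = cut n' a' j" "cut n b j = cut n' b' j" if "j < N" for j
    using that by auto
  have "n = n'"
    using eq[OF k(1)] eq[OF k(2)] E(3) E'(3) by (auto simp: cut_def split: if_splits)
  moreover have "a j = a' j \<and> b j = b' j" if "j \<le> n" for j
    using eq[of j] that k \<open>n = n'\<close> by (simp add: cut_def)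
  ultimately show ?thesis by blast
qed

lemma gauss_happy_fun_eq:
  assumes "B \<ge> 2" "z \<in> gauss_ints" "z \<noteq> 0" "gauss_expansion B z n a b"
  shows "gauss_happy_fun B z = (\<Sum>j\<le>n. (Complex (of_int (a j)) (of_int (b j)))\<^sup>2)"
proof -
  have "(THE w. \<exists>n a b. gauss_expansion B z n a b \<and>
           w = (\<Sum>j\<le>n. (Complex (of_int (a j)) (of_int (b j)))\<^sup>2))
        = (\<Sum>j\<le>n. (Complex (of_int (a j)) (of_int (b j)))\<^sup>2)"
  proof (rule the_equality)
    fix w
    assume "\<exists>n a b. gauss_expansion B z n a b \<and>
              w = (\<Sum>j\<le>n. (Complex (of_int (a j)) (of_int (b j)))\<^sup>2)"
    then obtain n' a' b' where *: "gauss_expansion B z n' a' b'"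
      "w = (\<Sum>j\<le>n'. (Complex (of_int (a' j)) (of_int (b' j)))\<^sup>2)" by blast
    show "w = (\<Sum>j\<le>n. (Complex (of_int (a j)) (of_int (b j)))\<^sup>2)"
      using gauss_expansion_unique[OF assms(1,2,4) *(1)] *(2) by simp
  qed (use assms(4) in blast)
  with assms(3) show ?thesis by (simp add: gauss_happy_fun_def)
qed

end

theory Submission
  imports Defs
begin

text \<open>
  On a nonnegative integer \<open>S\<^sub>B\<close> is the sum \<open>S\<close> of the squares of the base-\<open>B\<close> digits, and
  \<open>S\<^sub>B (i n) = - S n\<close>, \<open>S\<^sub>B (- n) = S n\<close>; so if \<open>n\<close> is an ordinary happy number, then \<open>n\<close> and
  \<open>i n\<close> are Gaussian happy, and the existence of all four kinds of sequences reduces to ordinary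
  happy numbers.

  Call a finite set \<open>T\<close> good if some translate of it consists of happy numbers.  If \<open>S ` T\<close> is good,
  so is \<open>T\<close>: appending \<open>x\<close> leading digits \<open>1\<close> to a number of bounded length adds \<open>x\<close> to \<open>S\<close>.
  Two elements of \<open>T\<close> whose difference is divisible by \<open>B - 1\<close> become equal after a translation and
  an application of \<open>S\<close>, because \<open>S (B\<^sup>r + v) = S (B\<^sup>r + B v)\<close> for large \<open>r\<close>.  If the
  difference \<open>\<delta>\<close> is only divisible by \<open>d\<close>, translate the two elements to \<open>u B\<^sup>s\<close> and \<open>u B\<^sup>s - \<delta>\<close>; their
  values under \<open>S\<close> differ by \<open>2 u - 1 - S (B\<^sup>s - \<delta>)\<close>, which for a suitable digit \<open>u\<close> is divisible by \<open>B - 1\<close>.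
  Hence every finite set of numbers congruent modulo \<open>d\<close> is good, by induction on its size.

  For odd \<open>B\<close> the parity of \<open>a + b\<close> is preserved by \<open>S\<^sub>B\<close>, so two happy numbers never differ by \<open>1\<close>.
\<close>

section \<open>Sums of squares of digits\<close>

text \<open>For \<open>b = 1\<close> the quotient never shrinks, so the guard \<open>b < 2\<close>
  is what makes the recursion terminate.\<close>

fun digit_sq_sum :: "nat \<Rightarrow> nat \<Rightarrow> nat" where
  "digit_sq_sum b n = (if n = 0 \<or> b < 2 then 0 else (n mod b)\<^sup>2 + digit_sq_sum b (n div b))"

declare digit_sq_sum.simps [simp del]

lemma digit_sq_sum_0 [simp]: "digit_sq_sum b 0 = 0"
  by (simp add: digit_sq_sum.simps)

lemma digit_sq_sum_rec:
  assumes "b \<ge> 2"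
  shows "digit_sq_sum b n = (n mod b)\<^sup>2 + digit_sq_sum b (n div b)"
  using assms by (cases "n = 0") (simp_all add: digit_sq_sum.simps[of b n])

lemma digit_sq_sum_digit:
  assumes "u < b"
  shows "digit_sq_sum b u = u\<^sup>2"
  using assms by (cases "u = 0") (simp_all add: digit_sq_sum.simps[of b u])

text \<open>The digits of \<open>t\<close> fill only the lowest \<open>r\<close> places and those of
  \<open>N\<close> start above them, so no carry occurs; padding zeros contribute nothing.\<close>

lemma digit_sq_sum_add_power_mult:
  assumes "b \<ge> 2" "t < b ^ r"
  shows "digit_sq_sum b (t + b ^ r * N) = digit_sq_sum b t + digit_sq_sum b N"
  using assms(2)
proof (induction r arbitrary: t)
  case 0
  then show ?case by simp
next
  case (Suc r)
  have "t div b < b ^ r"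
    using Suc.prems assms(1) by (simp add: div_less_iff_less_mult mult.commute)
  moreover have "(t + b ^ Suc r * N) mod b = t mod b"
    by (simp add: mult.assoc)
  moreover have "(t + b ^ Suc r * N) div b = t div b + b ^ r * N"
    using assms(1) by (simp add: mult.assoc)
  ultimately show ?case
    using Suc.IH digit_sq_sum_rec[OF assms(1), of t]
      digit_sq_sum_rec[OF assms(1), of "t + b ^ Suc r * N"] by simp
qed

lemma digit_sq_sum_base_mult:
  assumes "b \<ge> 2"
  shows "digit_sq_sum b (b * N) = digit_sq_sum b N"
  using digit_sq_sum_add_power_mult[OF assms, of 0 1 N] assms by simp

lemma digit_sq_sum_surj:
  assumes "b \<ge> 2"
  shows "\<exists>N. digit_sq_sum b N = x"
proof (induction x)
  case 0
  show ?case by (rule exI[of _ 0]) simp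
next
  case (Suc x)
  then obtain N where "digit_sq_sum b N = x" by blast
  then have "digit_sq_sum b (1 + b ^ 1 * N) = Suc x"
    using assms by (subst digit_sq_sum_add_power_mult) (simp_all add: digit_sq_sum_digit)
  then show ?case by blast
qed

text \<open>Modulo \<open>d\<close> each digit equals its square, because \<open>d\<close> divides
  2, and each power of \<open>b\<close> is 1. Applying the digit function therefore keeps a set
  inside one class modulo \<open>d\<close>.\<close>

lemma digit_sq_sum_cong:
  fixes d :: int
  assumes "b \<ge> 2" "d dvd 2" "d dvd int b - 1"
  shows "d dvd int (digit_sq_sum b n) - int n"
proof (induction n rule: less_induct)
  case (less n)
  show ?case
  proof (cases "n = 0")
    case False
    define r q where "r = int (n mod b)" and "q = n div b"
    have n: "int n = int b * int q + r"
      by (simp add: r_def q_def flip: of_nat_mult of_nat_add)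
    have "q < n" using False assms(1) by (simp add: q_def)
    then have "d dvd int (digit_sq_sum b q) - int q" by (rule less)
    moreover have "2 dvd r\<^sup>2 - r" by simp
    then have "d dvd r\<^sup>2 - r" using assms(2) dvd_trans by blast
    moreover have "int (digit_sq_sum b n) - int n =
        (int (digit_sq_sum b q) - int q) + (r\<^sup>2 - r) - (int b - 1) * int q"
      using n digit_sq_sum_rec[OF assms(1), of n]
      by (simp add: r_def q_def algebra_simps)
    ultimately show ?thesis using assms(3) by (metis dvd_add dvd_diff dvd_mult2)
  qed simp
qed

section \<open>Good sets\<close>

text \<open>Here \<open>k = 0\<close> is allowed, unlike in \<open>gauss_happy\<close>; as 1 is a
  fixed point for \<open>b \<ge> 2\<close>, iterations can be added at will.\<close>

definition happy :: "nat \<Rightarrow> nat \<Rightarrow> bool" where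
  "happy b n \<longleftrightarrow> (\<exists>k. (digit_sq_sum b ^^ k) n = 1)"

definition good :: "nat \<Rightarrow> nat set \<Rightarrow> bool" where
  "good b T \<longleftrightarrow> (\<exists>n. \<forall>t\<in>T. happy b (t + n))"

lemma happy_digit_sq_sumD:
  assumes "happy b (digit_sq_sum b n)"
  shows "happy b n"
  using assms unfolding happy_def by (metis comp_apply funpow_Suc_right)

lemma less_power_self:
  assumes "b \<ge> 2"
  shows "n < (b :: nat) ^ n"
  by (rule less_le_trans[OF less_exp power_mono]) (use assms in auto)

lemma good_singleton:
  assumes "b \<ge> 2"
  shows "good b {t}"
proof -
  have "digit_sq_sum b (b ^ t) = 1"
    using digit_sq_sum_add_power_mult[OF assms, of 0 t 1] assms by (simp add: digit_sq_sum_digit)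
  then have "(digit_sq_sum b ^^ 1) (b ^ t) = 1"
    by simp
  then have "happy b (b ^ t)"
    unfolding happy_def by blast
  then show ?thesis
    using less_power_self[OF assms, of t] unfolding good_def
    by (intro exI[of _ "b ^ t - t"]) simp
qed

lemma good_image:
  assumes "b \<ge> 2" "finite T" "good b ((\<lambda>t. digit_sq_sum b (t + n)) ` T)"
  shows "good b T"
proof -
  obtain x where x: "happy b (digit_sq_sum b (t + n) + x)" if "t \<in> T" for t
    using assms(3) by (auto simp: good_def)
  obtain N where N: "digit_sq_sum b N = x"
    using digit_sq_sum_surj[OF assms(1)] by blast
  \<comment> \<open>The block \<open>N\<close> is placed above every \<open>t + n\<close>;
    \<open>insert 0\<close> keeps \<open>Max\<close> meaningful for empty \<open>T\<close>.\<close>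
  define r where "r = Max (insert 0 T) + n"
  have "happy b (t + (n + b ^ r * N))" if "t \<in> T" for t
  proof -
    have "t + n \<le> r"
      using that assms(2) by (simp add: r_def)
    then have "t + n < b ^ r"
      using less_power_self[OF assms(1), of r] by simp
    then have "digit_sq_sum b (t + n + b ^ r * N) = digit_sq_sum b (t + n) + x"
      using digit_sq_sum_add_power_mult[OF assms(1)] N by simp
    then show ?thesis
      using x[OF that] happy_digit_sq_sumD by (metis add.assoc)
  qed
  then show ?thesis
    unfolding good_def by blast
qed

section \<open>Making two elements collide\<close>

lemma exists_digit_double_cong:
  fixes x :: int
  assumes "b \<ge> 2" "gcd 2 (int b - 1) dvd x"
  shows "\<exists>u. 1 \<le> u \<and> u < b \<and> int b - 1 dvd 2 * int u - x"
proof -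
  define M where "M = int b - 1"
  have M: "M > 0" using assms(1) by (simp add: M_def)
  obtain p q where pq: "p * 2 + q * M = gcd 2 M" using bezout_int by blast
  obtain y where y: "x = gcd 2 M * y" using assms(2) by (auto simp: M_def)
  \<comment> \<open>Bezout gives the solution \<open>p * y\<close> modulo \<open>M\<close>. Shifting
    by 1 before reducing and back afterwards puts it in the range from 1 to \<open>M\<close>, so
    that the digit is nonzero.\<close>
  define v where "v = (p * y - 1) mod M"
  have v: "0 \<le> v" "v < M" using M by (simp_all add: v_def)
  have "M dvd (p * y - 1) - v" by (simp add: v_def minus_mod_eq_mult_div)
  then obtain w where w: "p * y - 1 - v = M * w" by blast
  have "2 * (v + 1) - x = M * (- 2 * w - q * y)"
  proof -
    have "v + 1 = p * y - M * w" using w by simp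
    moreover have "x = (p * 2 + q * M) * y" using y pq by simp
    ultimately show ?thesis by (simp add: algebra_simps)
  qed
  then have "M dvd 2 * (v + 1) - x" by simp
  moreover have "int (nat (v + 1)) = v + 1" using v by simp
  ultimately show ?thesis
    using v by (intro exI[of _ "nat (v + 1)"]) (auto simp: M_def)
qed

lemma translate_cong:
  assumes "b \<ge> 2" "gcd 2 (int b - 1) dvd int s - int t"
  shows "\<exists>n. int b - 1 dvd int (digit_sq_sum b (s + n)) - int (digit_sq_sum b (t + n))"
  using assms(2)
proof (induction s t rule: linorder_wlog)
  case (sym s t)
  then show ?case by (metis dvd_diff_commute)
next
  case (le s t)
  define \<delta> where "\<delta> = t - s"
  define x where "x = digit_sq_sum b (b ^ t - \<delta>)"
  let ?d = "gcd 2 (int b - 1)"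
  show ?case
  proof (cases "s = t")
    case False
    then have \<delta>: "0 < \<delta>" "\<delta> \<le> t" "int \<delta> = int t - int s"
      using le by (auto simp: \<delta>_def)
    have t: "t < b ^ t" by (rule less_power_self[OF assms(1)])
    \<comment> \<open>Modulo \<open>?d\<close>, \<open>x\<close> is congruent to
      \<open>b ^ t - \<delta>\<close>, hence to 1, so \<open>1 + x\<close> is congruent to 2 and
      thus to 0.\<close>
    have "?d dvd int x - int (b ^ t - \<delta>)"
      unfolding x_def by (rule digit_sq_sum_cong) (use assms in simp_all)
    moreover have "?d dvd int b ^ t - 1"
    proof -
      have "int b - 1 dvd int b ^ t - 1" by (simp add: power_diff_1_eq)
      then show ?thesis using dvd_trans gcd_dvd2 by blast
    qed
    moreover have "?d dvd int \<delta>" using le \<delta>(3) by (metis dvd_diff_commute)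
    moreover have "1 + int x =
        (int x - int (b ^ t - \<delta>)) + (int b ^ t - 1) - int \<delta> + 2"
      using \<delta> t by (simp add: of_nat_diff)
    ultimately have "?d dvd 1 + int x"
      by (metis dvd_add dvd_diff gcd_dvd1)
    then obtain u where u: "1 \<le> u" "u < b" "int b - 1 dvd 2 * int u - (1 + int x)"
      using exists_digit_double_cong[OF assms(1)] by blast
    then obtain u' where u': "u = Suc u'" by (cases u) auto
    \<comment> \<open>This sends \<open>t\<close> to \<open>u * b ^ t\<close> and \<open>s\<close>
      to \<open>u * b ^ t - \<delta>\<close>. The borrow lowers the leading digit to
      \<open>u'\<close>, and the difference of the two squares is linear in
      \<open>u\<close>.\<close>
    define n where "n = u * b ^ t - t"
    have n: "t + n = b ^ t * u" "s + n = (b ^ t - \<delta>) + b ^ t * u'"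
      using t \<delta> le u' by (auto simp: n_def \<delta>_def algebra_simps)
    have "digit_sq_sum b (t + n) = u\<^sup>2"
      using digit_sq_sum_add_power_mult[OF assms(1), of 0 t u] assms(1) u
      by (simp add: n digit_sq_sum_digit)
    moreover have "digit_sq_sum b (s + n) = x + u'\<^sup>2"
      using digit_sq_sum_add_power_mult[OF assms(1), of "b ^ t - \<delta>" t u'] t \<delta>(1) u u'
      by (simp add: n x_def digit_sq_sum_digit)
    ultimately have "int (digit_sq_sum b (t + n)) - int (digit_sq_sum b (s + n)) =
        2 * int u - (1 + int x)"
      by (simp add: u' power2_eq_square algebra_simps)
    then show ?thesis using u(3) by (metis dvd_diff_commute)
  qed simp
qed

lemma translate_merge:
  assumes "b \<ge> 2" "int b - 1 dvd int s - int t"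
  shows "\<exists>n. digit_sq_sum b (s + n) = digit_sq_sum b (t + n)"
  using assms(2)
proof (induction s t rule: linorder_wlog)
  case (sym s t)
  then show ?case by (metis dvd_diff_commute)
next
  case (le s t)
  have "int b - 1 dvd int (t - s)"
    using le by (metis dvd_diff_commute of_nat_diff)
  then have "b - 1 dvd t - s"
    using assms(1) by (metis int_dvd_int_iff int_ops(6) of_nat_1 of_nat_diff one_le_numeral order_trans)
  then obtain v where v: "t - s = (b - 1) * v" by blast
  \<comment> \<open>Large enough that the subtraction defining \<open>n\<close> is not truncated and
    both \<open>v\<close> and \<open>b * v\<close> lie below \<open>b ^ r\<close>.\<close>
  define r where "r = s + b * v"
  have r: "r < b ^ r" by (rule less_power_self[OF assms(1)])
  have vb: "v \<le> b * v" using assms(1) by simp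
  define n where "n = b ^ r + v - s"
  have n: "s + n = v + b ^ r * 1"
    using r by (simp add: n_def r_def)
  have "t = s + (b - 1) * v" using v le by simp
  then have "t + n = v + b ^ r + (b - 1) * v"
    using n by simp
  also have "\<dots> = b * v + b ^ r * 1"
    using vb by (simp add: diff_mult_distrib)
  finally have n': "t + n = b * v + b ^ r * 1" .
  have "v < b ^ r" "b * v < b ^ r"
    using r vb unfolding r_def by linarith+
  then have "digit_sq_sum b (s + n) = digit_sq_sum b (t + n)"
    unfolding n n' using assms(1) by (simp only: digit_sq_sum_add_power_mult digit_sq_sum_base_mult)
  then show ?case by blast
qed

text \<open>Two rounds of translating and applying the digit function identify a chosen pair: the
  first makes the difference divisible by \<open>b - 1\<close>, the second makes it zero. The image
  is smaller and still in one class, and goodness is pulled back twice by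
  \<open>good_image\<close>.\<close>

lemma good_if_cong:
  assumes "b \<ge> 2" "finite T" "T \<noteq> {}"
    and "\<And>s t. s \<in> T \<Longrightarrow> t \<in> T \<Longrightarrow> gcd 2 (int b - 1) dvd int s - int t"
  shows "good b T"
  using assms(2-)
proof (induction "card T" arbitrary: T rule: less_induct)
  case less
  let ?d = "gcd 2 (int b - 1)"
  show ?case
  proof (cases "\<exists>s\<in>T. \<exists>t\<in>T. s \<noteq> t")
    case False
    then obtain t where "T = {t}" using less.prems(2) by blast
    then show ?thesis using good_singleton[OF assms(1)] by simp
  next
    case True
    then obtain s t where st: "s \<in> T" "t \<in> T" "s \<noteq> t" by blast
    obtain n where n: "int b - 1 dvd int (digit_sq_sum b (s + n)) - int (digit_sq_sum b (t + n))"
      using translate_cong[OF assms(1) less.prems(3)[OF st(1,2)]] by blast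
    obtain k where k: "digit_sq_sum b (digit_sq_sum b (s + n) + k) =
        digit_sq_sum b (digit_sq_sum b (t + n) + k)"
      using translate_merge[OF assms(1) n] by blast
    define f where "f n x = digit_sq_sum b (x + n)" for n x
    have f: "?d dvd int (f n x) - int (f n y)" if "?d dvd int x - int y" for n x y
    proof -
      have c: "?d dvd int (f n z) - int (z + n)" for z
        unfolding f_def by (rule digit_sq_sum_cong) (use assms(1) in simp_all)
      have "int (f n x) - int (f n y) =
          (int (f n x) - int (x + n)) - (int (f n y) - int (y + n)) + (int x - int y)"
        by simp
      then show ?thesis using c that by (metis dvd_add dvd_diff)
    qed
    let ?T' = "f k ` f n ` T"
    have "\<not> inj_on (f k \<circ> f n) T"
      using st k by (auto simp: inj_on_def f_def)
    then have "card ((f k \<circ> f n) ` T) \<noteq> card T"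
      using less.prems(1) eq_card_imp_inj_on by blast
    then have "card ?T' < card T"
      using card_image_le[OF less.prems(1), of "f k \<circ> f n"] by (simp add: image_comp)
    then have "good b ?T'"
      by (rule less.hyps) (use less.prems f in auto)
    then show ?thesis
      using good_image[OF assms(1)] less.prems(1) unfolding f_def by blast
  qed
qed

lemma consecutive_happy:
  assumes "b \<ge> 2" "int d = gcd 2 (int b - 1)"
  shows "\<exists>n. \<forall>j<m. happy b (n + j * d)"
proof -
  \<comment> \<open>The closed range keeps the set nonempty even for \<open>m = 0\<close>.\<close>
  have "good b ((\<lambda>j. j * d) ` {..m})"
    by (rule good_if_cong[OF assms(1)]) (auto simp: assms(2)[symmetric])
  then show ?thesis
    by (fastforce simp: good_def add.commute)
qed

section \<open>Gaussian happy numbers\<close>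

lemma digit_sq_sum_expansion:
  assumes "b \<ge> 2" "n > 0"
  shows "\<exists>N a. int n = (\<Sum>j\<le>N. a j * int b ^ j) \<and> a N \<noteq> 0 \<and>
    (\<forall>j\<le>N. 0 \<le> a j \<and> a j \<le> int b - 1) \<and> int (digit_sq_sum b n) = (\<Sum>j\<le>N. (a j)\<^sup>2)"
  using assms(2)
proof (induction n rule: less_induct)
  case (less n)
  show ?case
  proof (cases "n < b")
    case True
    then show ?thesis
      using less.prems
      by (intro exI[of _ 0] exI[of _ "\<lambda>_. int n"]) (auto simp: digit_sq_sum_digit)
  next
    case False
    define q where "q = n div b"
    have "q < n" "q > 0"
      using False assms(1) by (auto simp: q_def div_greater_zero_iff)
    then obtain N a where a: "int q = (\<Sum>j\<le>N. a j * int b ^ j)" "a N \<noteq> 0"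
      "\<forall>j\<le>N. 0 \<le> a j \<and> a j \<le> int b - 1" "int (digit_sq_sum b q) = (\<Sum>j\<le>N. (a j)\<^sup>2)"
      using less.IH by blast
    \<comment> \<open>The last digit of \<open>n\<close> takes index 0 and shifts the digits of the
      quotient up by one.\<close>
    define c where "c = case_nat (int (n mod b)) a"
    have "int n = int (n mod b) + int b * int q"
      by (simp add: q_def flip: of_nat_mult of_nat_add)
    then have "int n = (\<Sum>j\<le>Suc N. c j * int b ^ j)"
      unfolding sum.atMost_Suc_shift
      by (simp add: c_def a(1) sum_distrib_left mult.left_commute)
    moreover have "int (digit_sq_sum b n) = (\<Sum>j\<le>Suc N. (c j)\<^sup>2)"
      unfolding sum.atMost_Suc_shift
      by (simp add: c_def digit_sq_sum_rec[OF assms(1), of n] a(4)[symmetric] q_def)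
    moreover have "0 \<le> c j \<and> c j \<le> int b - 1" if "j \<le> Suc N" for j
    proof -
      have "n mod b < b" using assms(1) by simp
      then show ?thesis using that a(3) by (cases j) (auto simp: c_def)
    qed
    moreover have "c (Suc N) \<noteq> 0" using a(2) by (simp add: c_def)
    ultimately show ?thesis by blast
  qed
qed

text \<open>The digits are \<open>a j\<close>, \<open>- a j\<close> and \<open>\<i> * a j\<close>,
  and only the last kind has negative squares. The negative axis matters because the imaginary axis
  is mapped into it.\<close>

lemma gauss_happy_fun_axes:
  assumes "b \<ge> 2"
  shows "gauss_happy_fun (int b) (of_nat n) = of_nat (digit_sq_sum b n)
    \<and> gauss_happy_fun (int b) (- of_nat n) = of_nat (digit_sq_sum b n)
    \<and> gauss_happy_fun (int b) (\<i> * of_nat n) = - of_nat (digit_sq_sum b n)"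
proof (cases "n = 0")
  case True
  then show ?thesis by (simp add: gauss_happy_fun_def)
next
  case False
  then have n0: "n > 0" by simp
  obtain N a where a: "int n = (\<Sum>j\<le>N. a j * int b ^ j)" "a N \<noteq> 0"
      "\<forall>j\<le>N. 0 \<le> a j \<and> a j \<le> int b - 1" "int (digit_sq_sum b n) = (\<Sum>j\<le>N. (a j)\<^sup>2)"
    using digit_sq_sum_expansion[OF assms n0] by blast
  have B: "int b \<ge> 2" using assms by simp
  have eq: "of_nat n = Complex (of_int (int n)) (of_int 0)"
    "- of_nat n = Complex (of_int (- int n)) (of_int 0)"
    "\<i> * of_nat n = Complex (of_int 0) (of_int (int n))"
    by (simp_all add: complex_eq_iff)
  have G: "Complex (of_int x) (of_int y) \<in> gauss_ints" for x y
    by (auto simp: gauss_ints_def)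
  have S: "(\<Sum>j\<le>N. (of_int (a j))\<^sup>2) = (of_nat (digit_sq_sum b n) :: complex)"
    using arg_cong[OF a(4), of "of_int :: int \<Rightarrow> complex"] by simp
  have sq: "(Complex (of_int x) 0)\<^sup>2 = (of_int x)\<^sup>2" "(Complex 0 (of_int x))\<^sup>2 = - (of_int x)\<^sup>2" for x
    by (simp_all add: complex_eq_iff power2_eq_square)
  have "gauss_expansion (int b) (Complex (of_int (int n)) (of_int 0)) N a (\<lambda>_. 0)"
    unfolding gauss_expansion_Complex_iff using a n0 by auto
  from gauss_happy_fun_eq[OF B G _ this] n0
  have 1: "gauss_happy_fun (int b) (of_nat n) = of_nat (digit_sq_sum b n)"
    unfolding eq(1) by (simp add: complex_eq_iff[of _ 0] sq S)
  have "gauss_expansion (int b) (Complex (of_int (- int n)) (of_int 0)) N (\<lambda>j. - a j) (\<lambda>_. 0)"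
    unfolding gauss_expansion_Complex_iff using a n0 by (auto simp: sum_negf)
  from gauss_happy_fun_eq[OF B G _ this] n0
  have 2: "gauss_happy_fun (int b) (- of_nat n) = of_nat (digit_sq_sum b n)"
    unfolding eq(2) using sq(1)[of "- _"] by (simp add: complex_eq_iff[of _ 0] S)
  have "gauss_expansion (int b) (Complex (of_int 0) (of_int (int n))) N (\<lambda>_. 0) a"
    unfolding gauss_expansion_Complex_iff using a n0 by auto
  from gauss_happy_fun_eq[OF B G _ this] n0
  have "gauss_happy_fun (int b) (\<i> * of_nat n) = - of_nat (digit_sq_sum b n)"
    unfolding eq(3) by (simp add: complex_eq_iff[of _ 0] sq S sum_negf)
  with 1 2 show ?thesis by blast
qed

lemma gauss_happy_fun_funpow:
  assumes "b \<ge> 2"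
  shows "(gauss_happy_fun (int b) ^^ k) (of_nat n) = of_nat ((digit_sq_sum b ^^ k) n)"
  by (induction k) (simp_all add: gauss_happy_fun_axes[OF assms])

lemma happy_imp_gauss_happy:
  assumes "b \<ge> 2" "happy b n"
  shows "gauss_happy (int b) (of_nat n)" "gauss_happy (int b) (\<i> * of_nat n)"
proof -
  obtain k where k: "(digit_sq_sum b ^^ k) n = 1" using assms(2) by (auto simp: happy_def)
  have one: "digit_sq_sum b 1 = 1" using assms(1) by (simp add: digit_sq_sum_digit)
  \<comment> \<open>Two extra iterations bring \<open>\<i> * n\<close> back to the nonnegative axis,
    by way of the nonpositive one.\<close>
  have k2: "(digit_sq_sum b ^^ Suc (Suc k)) n = 1" using k one by simp
  have G: "of_nat n \<in> gauss_ints" "\<i> * of_nat n \<in> gauss_ints"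
    by (auto simp: gauss_ints_def complex_eq_iff intro: exI[of _ "int n"] exI[of _ 0])
  have "(gauss_happy_fun (int b) ^^ Suc (Suc k)) (of_nat n) = 1"
    unfolding gauss_happy_fun_funpow[OF assms(1)] k2 by simp
  then show "gauss_happy (int b) (of_nat n)"
    unfolding gauss_happy_def using G by (metis Suc_le_mono le0 One_nat_def)
  have "(gauss_happy_fun (int b) ^^ Suc (Suc k)) (\<i> * of_nat n) =
      (gauss_happy_fun (int b) ^^ k) (of_nat (digit_sq_sum b (digit_sq_sum b n)))"
    by (simp only: funpow_Suc_right o_apply gauss_happy_fun_axes[OF assms(1)])
  also have "\<dots> = of_nat ((digit_sq_sum b ^^ Suc (Suc k)) n)"
    unfolding gauss_happy_fun_funpow[OF assms(1)] by (simp only: funpow_Suc_right o_apply)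
  finally show "gauss_happy (int b) (\<i> * of_nat n)"
    unfolding gauss_happy_def using G k2 by (metis Suc_le_mono le0 One_nat_def of_nat_1)
qed

section \<open>Arbitrarily long Gaussian sequences\<close>

lemma arb_long_happy_seqs_iff:
  "arb_long_happy_seqs B D \<longleftrightarrow>
    (\<forall>m\<ge>1. \<exists>z\<in>gauss_ints. \<forall>j<m. gauss_happy B (z + of_nat j * D))"
proof -
  have "(\<exists>zs. consecutive_seq D m zs \<and> (\<forall>z\<in>set zs. gauss_happy B z)) \<longleftrightarrow>
      (\<exists>z\<in>gauss_ints. \<forall>w\<in>set (map (\<lambda>j. z + of_nat j * D) [0..<m]). gauss_happy B w)" for m
    unfolding consecutive_seq_def by blast
  moreover have "(\<forall>w\<in>set (map (\<lambda>j. z + of_nat j * D) [0..<m]). gauss_happy B w) \<longleftrightarrow>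
      (\<forall>j<m. gauss_happy B (z + of_nat j * D))" for z m
    by auto
  ultimately show ?thesis
    unfolding arb_long_happy_seqs_def by simp
qed

text \<open>A sequence read backwards from its last term \<open>y\<close> has the opposite step;
  \<open>y\<close> is a Gaussian integer because it is happy.\<close>

lemma arb_long_happy_seqs_uminus:
  assumes "arb_long_happy_seqs B (of_nat d * w)" "w = 1 \<or> w = \<i>"
  shows "arb_long_happy_seqs B (- (of_nat d * w))"
  unfolding arb_long_happy_seqs_iff
proof (intro allI impI)
  fix m :: nat assume "m \<ge> 1"
  let ?D = "of_nat d * w"
  obtain z where z: "\<forall>j<m. gauss_happy B (z + of_nat j * ?D)"
    using assms(1) \<open>m \<ge> 1\<close> unfolding arb_long_happy_seqs_iff by blast
  define y where "y = z + of_nat (m - 1) * ?D"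
  have "y \<in> gauss_ints"
    using z[rule_format, of "m - 1"] \<open>m \<ge> 1\<close> unfolding y_def gauss_happy_def by simp
  moreover have "gauss_happy B (y + of_nat j * - ?D)" if "j < m" for j
  proof -
    have "y + of_nat j * - ?D = z + of_nat (m - 1 - j) * ?D"
      using that by (simp add: y_def of_nat_diff algebra_simps)
    moreover have "gauss_happy B (z + of_nat (m - 1 - j) * ?D)"
      using z that by (simp del: of_nat_diff)
    ultimately show ?thesis by (simp only:)
  qed
  ultimately show "\<exists>y\<in>gauss_ints. \<forall>j<m. gauss_happy B (y + of_nat j * - ?D)"
    by blast
qed

lemma arb_long_happy_seqs_gcd:
  assumes "b \<ge> 2" "int d = gcd 2 (int b - 1)" "w = 1 \<or> w = \<i>"
  shows "arb_long_happy_seqs (int b) (of_nat d * w)"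
  unfolding arb_long_happy_seqs_iff
proof (intro allI impI)
  fix m :: nat assume m: "m \<ge> 1"
  obtain n where n: "\<forall>j<m. happy b (n + j * d)"
    using consecutive_happy[OF assms(1,2)] by blast
  have H: "gauss_happy (int b) (w * of_nat n + of_nat j * (of_nat d * w))" if "j < m" for j
  proof -
    have "w * of_nat n + of_nat j * (of_nat d * w) = w * of_nat (n + j * d)"
      by (simp add: algebra_simps)
    moreover have "gauss_happy (int b) (w * of_nat (n + j * d))"
      using happy_imp_gauss_happy[OF assms(1), of "n + j * d"] n that assms(3)
      by (auto simp del: of_nat_add of_nat_mult)
    ultimately show ?thesis by (simp only:)
  qed
  have "w * of_nat n \<in> gauss_ints"
    using H[of 0] m by (simp add: gauss_happy_def)
  then show "\<exists>z\<in>gauss_ints. \<forall>j<m. gauss_happy (int b) (z + of_nat j * (of_nat d * w))"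
    using H by blast
qed

section \<open>Parity\<close>

text \<open>A digit pair contributes \<open>a\<^sup>2 - b\<^sup>2 + 2 * a * b\<close> to the new
  coordinate sum, which has the parity of \<open>a + b\<close>; odd powers of the base do not alter
  that parity.\<close>

lemma gauss_happy_fun_parity:
  fixes x y :: int
  assumes "B \<ge> 2" "odd B"
  shows "\<exists>x' y'. gauss_happy_fun B (Complex (of_int x) (of_int y)) = Complex (of_int x') (of_int y')
    \<and> (even (x' + y') \<longleftrightarrow> even (x + y))"
proof (cases "Complex (of_int x) (of_int y) = 0")
  case True
  then show ?thesis
    by (intro exI[of _ 0]) (auto simp: gauss_happy_fun_def complex_eq_iff)
next
  case False
  have G: "Complex (of_int x) (of_int y) \<in> gauss_ints" by (auto simp: gauss_ints_def)
  obtain n a b where e: "gauss_expansion B (Complex (of_int x) (of_int y)) n a b"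
    using gauss_expansion_exists[OF assms(1) G False] by blast
  define x' where "x' = (\<Sum>j\<le>n. (a j)\<^sup>2 - (b j)\<^sup>2)"
  define y' where "y' = (\<Sum>j\<le>n. 2 * a j * b j)"
  have "(\<Sum>j\<le>n. (Complex (of_int (a j)) (of_int (b j)))\<^sup>2) = Complex (of_int x') (of_int y')"
    by (rule complex_eqI) (simp_all add: x'_def y'_def power2_eq_square algebra_simps)
  then have "gauss_happy_fun B (Complex (of_int x) (of_int y)) = Complex (of_int x') (of_int y')"
    using gauss_happy_fun_eq[OF assms(1) G False e] by simp
  moreover have "even (x' + y') \<longleftrightarrow> even (x + y)"
  proof -
    have "x = (\<Sum>j\<le>n. a j * B ^ j)" "y = (\<Sum>j\<le>n. b j * B ^ j)"
      using e unfolding gauss_expansion_Complex_iff by blast+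
    then have "x' + y' - (x + y) =
        (\<Sum>j\<le>n. (a j)\<^sup>2 - (b j)\<^sup>2 + 2 * a j * b j - (a j * B ^ j + b j * B ^ j))"
      by (simp add: x'_def y'_def sum.distrib sum_subtractf)
    moreover have "even ((a j)\<^sup>2 - (b j)\<^sup>2 + 2 * a j * b j - (a j * B ^ j + b j * B ^ j))" for j
      using assms(2) by simp
    ultimately have "even (x' + y' - (x + y))" by (simp only: dvd_sum)
    then show ?thesis by simp
  qed
  ultimately show ?thesis by blast
qed

lemma gauss_happy_odd:
  fixes x y :: int
  assumes "B \<ge> 2" "odd B" "gauss_happy B (Complex (of_int x) (of_int y))"
  shows "odd (x + y)"
proof -
  have "\<exists>x' y'. (gauss_happy_fun B ^^ k) (Complex (of_int x) (of_int y)) =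
      Complex (of_int x') (of_int y') \<and> (even (x' + y') \<longleftrightarrow> even (x + y))" for k
  proof (induction k)
    case (Suc k)
    then show ?case using gauss_happy_fun_parity[OF assms(1,2)] by (metis comp_apply funpow.simps(2))
  qed auto
  then obtain x' y' :: int where "1 = Complex (of_int x') (of_int y')" "even (x' + y') \<longleftrightarrow> even (x + y)"
    using assms(3) unfolding gauss_happy_def by metis
  then show ?thesis by (auto simp: complex_eq_iff)
qed

lemma not_arb_long_happy_seqs_1:
  assumes "B \<ge> 2" "odd B"
  shows "\<not> arb_long_happy_seqs B 1"
proof
  assume "arb_long_happy_seqs B 1"
  then obtain z where z: "z \<in> gauss_ints" "\<forall>j<2. gauss_happy B (z + of_nat j * 1)"
    unfolding arb_long_happy_seqs_iff by (meson one_le_numeral)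
  then have H: "gauss_happy B z" "gauss_happy B (z + 1)"
    by (auto dest: spec[of _ 0] spec[of _ 1])
  obtain x y where xy: "z = Complex (of_int x) (of_int y)"
    using z(1) by (auto simp: gauss_ints_def)
  then have "z + 1 = Complex (of_int (x + 1)) (of_int y)"
    by (simp add: complex_eq_iff)
  then have "odd (x + y)" "odd (x + 1 + y)"
    using gauss_happy_odd[OF assms] H xy by metis+
  then show False by simp
qed

theorem theorem15:
  fixes B d :: int
  assumes "B \<ge> 2" and "d = gcd 2 (B - 1)"
  shows "(\<forall>D \<in> {of_int d, - of_int d, \<i> * of_int d, - \<i> * of_int d}. arb_long_happy_seqs B D)
    \<and> (d > 0 \<and> arb_long_happy_seqs B (of_int d)
       \<and> (\<forall>c::int. c > 0 \<and> arb_long_happy_seqs B (of_int c) \<longrightarrow> d \<le> c))"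
proof -
  define b where "b = nat B"
  define e where "e = nat d"
  have d: "d > 0" "d \<le> 2" using assms gcd_le1_int[of 2 "B - 1"] by auto
  have b: "b \<ge> 2" "B = int b" using assms(1) by (auto simp: b_def)
  have e: "int e = gcd 2 (int b - 1)" "(of_int d :: complex) = of_nat e"
    using d assms(2) b by (simp_all add: e_def)
  have A: "arb_long_happy_seqs B (of_nat e * 1)" "arb_long_happy_seqs B (of_nat e * \<i>)"
    unfolding b(2) by (rule arb_long_happy_seqs_gcd[OF b(1) e(1)]; simp)+
  have all: "\<forall>D \<in> {of_int d, - of_int d, \<i> * of_int d, - \<i> * of_int d}. arb_long_happy_seqs B D"
    using A A[THEN arb_long_happy_seqs_uminus] by (simp add: e(2) mult.commute)
  have "d \<le> c" if "c > 0" "arb_long_happy_seqs B (of_int c)" for c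
  proof (rule ccontr)
    assume "\<not> d \<le> c"
    \<comment> \<open>As \<open>d\<close> is at most 2, a smaller positive \<open>c\<close> leaves
      only this case, and \<open>d = 2\<close> forces \<open>B\<close> to be odd.\<close>
    then have "c = 1" "d = 2" using that d by auto
    then have "2 dvd B - 1" using assms(2) gcd_dvd2[of 2 "B - 1"] by simp
    then have "odd B" by simp
    then show False
      using not_arb_long_happy_seqs_1[OF assms(1)] that \<open>c = 1\<close> by simp
  qed
  with all d show ?thesis by simp
qed

end
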